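(* Consider a raster image of $N_x\times N_y$ pixels, regarded as a uniform square mesh in which each pixel $p$ is a square of constant intensity $I(p)$, placed in a coordinate system such that the image fits in the unit disk. Let $f$ be the resulting piecewise-constant intensity function. Let $S$ be the set of edges (horizontal and vertical) between the pixels. For an edge $e=(A,B)\in S$ shared by two adjacent pixels $p_1$ and $p_2$, where the boundary contour of $p_1$ traverses $e$ in the direction from $A$ to $B$ and that of $p_2$ traverses it in the opposite direction, put $$\Delta I_e=I(p_1)-I(p_2).$$ Then for all integers $n\ge 0$ and $m$ with $|m|\le n$ and $n-|m|$ even, the Zernike moment of the image, $$Z_n^m=\iint f(\boldsymbol{x})\,(V_n^m)^{\ast}(\boldsymbol{x})\,d\boldsymbol{x}$$ (integral over the image domain), is $$Z_n^m=\sum_{e\in S}Z_n^m(e),\qquad Z_n^m(e)=\Delta I_e\,\epsilon_{AB}\int_{-1}^{1}A_n^m(t)\,dt .$$ Consequently, an edge contributes to the total Zernike moment if and only if there is a difference in intensity between its two neighboring pixels; edges separating pixels of identical intensity have $\Delta I_e=0$ and vanish from the summation.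
   Context: The star denotes complex conjugation. For integers $n\ge 0$ and $m$ with $|m|\le n$ and $n-|m|$ even, the Zernike radial polynomial is $$R_n^{m}(r)=R_n^{|m|}(r)=\sum_{k=0}^{(n-|m|)/2}(-1)^k\frac{(n-k)!}{k!\left(\frac{n+|m|}{2}-k\right)!\left(\frac{n-|m|}{2}-k\right)!}\,r^{n-2k},$$ and the Zernike basis function on the unit disk is, in polar coordinates, $V_n^m(r,\theta)=\sqrt{\frac{n+1}{\pi}}\,R_n^m(r)\,e^{im\theta}$. The radial primitive is $Q_n^m(r)=\int_0^r s\,R_n^m(s)\,ds$. All pixel boundary contours are consistently oriented, counter-clockwise. For a directed edge $e=(A,B)$ with $A=(x_A,y_A)$, $B=(x_B,y_B)$, the orientation factor is the sign of the signed area of the triangle formed by the origin, $A$ and $B$: $\epsilon_{AB}=\mathrm{sign}\left(\tfrac12(x_Ay_B-y_Ax_B)\right)$. For $t\in[-1,1]$ the edge is parameterized by $x(t)=\frac{(1-t)x_A+(1+t)x_B}{2}$, $y(t)=\frac{(1-t)y_A+(1+t)y_B}{2}$, with $r(t)=\sqrt{x(t)^2+y(t)^2}$ and $\theta(t)$ the polar angle of $(x(t),y(t))$. With $C=(x_Ay_B-y_Ax_B)/2$ (a signed quantity), one sets $$A_n^m(t)=C\,\frac{Q_n^m(r(t))\,e^{-im\theta(t)}}{r(t)^2},$$ which depends on the edge $e$.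
   Formalization: Corrected: factor √((n+1)/π) before the edge sum; A_n^m uses |C| (or edges directed so that C≥0); S includes rim edges, outside intensity 0 (inner edges suffice if rim pixels are 0); "contributes if" needs a nonzero edge integral, or C≠0 and some (n,m). *)

theory Defs
  imports "HOL-Analysis.Analysis"
begin

section \<open>Zernike basis functions\<close>

definition zernike_index :: "nat \<Rightarrow> int \<Rightarrow> bool" where
  "zernike_index n m \<longleftrightarrow> \<bar>m\<bar> \<le> int n \<and> even (int n - \<bar>m\<bar>)"

definition zernike_R :: "nat \<Rightarrow> int \<Rightarrow> real \<Rightarrow> real" where
  "zernike_R n m r =
     (let a = nat \<bar>m\<bar> in
      \<Sum>k = 0..(n - a) div 2.
        (-1) ^ k * fact (n - k)
          / (fact k * fact ((n + a) div 2 - k) * fact ((n - a) div 2 - k))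
          * r ^ (n - 2 * k))"

definition zernike_Q :: "nat \<Rightarrow> int \<Rightarrow> real \<Rightarrow> real" where
  "zernike_Q n m r = integral {0..r} (\<lambda>s. s * zernike_R n m s)"

definition polar_radius :: "real \<times> real \<Rightarrow> real" where
  "polar_radius z = sqrt ((fst z)\<^sup>2 + (snd z)\<^sup>2)"

text \<open>The branch of the polar angle is immaterial: only \<open>exp (\<i> * m * polar_angle z)\<close>
  with integral \<open>m\<close> is used. At the origin the angle is \<open>0\<close> by convention.\<close>

definition polar_angle :: "real \<times> real \<Rightarrow> real" where
  "polar_angle z = Arg (Complex (fst z) (snd z))"

definition zernike_V :: "nat \<Rightarrow> int \<Rightarrow> real \<times> real \<Rightarrow> complex" where
  "zernike_V n m z =
     of_real (sqrt ((real n + 1) / pi) * zernike_R n m (polar_radius z))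
       * exp (\<i> * of_int m * of_real (polar_angle z))"


section \<open>Raster images\<close>

text \<open>Pixels and mesh nodes are both indexed by \<open>int \<times> int\<close>: pixel \<open>(i, j)\<close> is the square
  whose lower left corner is node \<open>(i, j)\<close>. Negative indices allow the cells surrounding
  the image to be named; they carry intensity \<open>0\<close>, in accordance with the image function
  being \<open>0\<close> there.\<close>

type_synonym pixel = "int \<times> int"
type_synonym node = "int \<times> int"
type_synonym edge = "node \<times> node"

definition pixels :: "nat \<Rightarrow> nat \<Rightarrow> pixel set" where
  "pixels Nx Ny = {0..<int Nx} \<times> {0..<int Ny}"

definition intensity :: "nat \<Rightarrow> nat \<Rightarrow> (pixel \<Rightarrow> real) \<Rightarrow> pixel \<Rightarrow> real" where
  "intensity Nx Ny I p = (if p \<in> pixels Nx Ny then I p else 0)"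

definition node_pos :: "real \<times> real \<Rightarrow> real \<Rightarrow> node \<Rightarrow> real \<times> real" where
  "node_pos c h v = (fst c + of_int (fst v) * h, snd c + of_int (snd v) * h)"

text \<open>Half-open squares make the pixels disjoint; their boundaries are null sets.\<close>

definition pixel_square :: "real \<times> real \<Rightarrow> real \<Rightarrow> pixel \<Rightarrow> (real \<times> real) set" where
  "pixel_square c h p =
     {fst (node_pos c h p)..<fst (node_pos c h p) + h}
       \<times> {snd (node_pos c h p)..<snd (node_pos c h p) + h}"

definition image_domain :: "real \<times> real \<Rightarrow> real \<Rightarrow> nat \<Rightarrow> nat \<Rightarrow> (real \<times> real) set" where
  "image_domain c h Nx Ny =
     {fst c..fst c + real Nx * h} \<times> {snd c..snd c + real Ny * h}"

definition image_fun ::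
    "real \<times> real \<Rightarrow> real \<Rightarrow> nat \<Rightarrow> nat \<Rightarrow> (pixel \<Rightarrow> real) \<Rightarrow> real \<times> real \<Rightarrow> real" where
  "image_fun c h Nx Ny I z =
     (\<Sum>p\<in>pixels Nx Ny. I p * indicator (pixel_square c h p) z)"

definition zernike_moment ::
    "real \<times> real \<Rightarrow> real \<Rightarrow> nat \<Rightarrow> nat \<Rightarrow> (pixel \<Rightarrow> real) \<Rightarrow> nat \<Rightarrow> int \<Rightarrow> complex" where
  "zernike_moment c h Nx Ny I n m =
     (LINT z:image_domain c h Nx Ny|lborel.
        of_real (image_fun c h Nx Ny I z) * cnj (zernike_V n m z))"


section \<open>Edges\<close>

text \<open>The four directed edges of the counter-clockwise boundary contour of a pixel.\<close>

definition contour :: "pixel \<Rightarrow> edge set" where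
  "contour p =
     (let (i, j) = p in
      {((i, j), (i + 1, j)), ((i + 1, j), (i + 1, j + 1)),
       ((i + 1, j + 1), (i, j + 1)), ((i, j + 1), (i, j))})"

lemma contour_unique:
  assumes "e \<in> contour p" "e \<in> contour q"
  shows "p = q"
  using assms by (auto simp: contour_def split: prod.splits)

lemma contour_neighbour:
  assumes "e \<in> contour p"
  shows "\<exists>!q. prod.swap e \<in> contour q"
proof -
  obtain i j where p: "p = (i, j)" by fastforce
  consider "e = ((i, j), (i + 1, j))" | "e = ((i + 1, j), (i + 1, j + 1))"
    | "e = ((i + 1, j + 1), (i, j + 1))" | "e = ((i, j + 1), (i, j))"
    using assms by (auto simp: contour_def p)
  then have "\<exists>q. prod.swap e \<in> contour q"
  proof cases
    case 1 then show ?thesis by (intro exI[of _ "(i, j - 1)"]) (simp add: contour_def)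
  next
    case 2 then show ?thesis by (intro exI[of _ "(i + 1, j)"]) (simp add: contour_def)
  next
    case 3 then show ?thesis by (intro exI[of _ "(i, j + 1)"]) (simp add: contour_def)
  next
    case 4 then show ?thesis by (intro exI[of _ "(i - 1, j)"]) (simp add: contour_def)
  qed
  then show ?thesis using contour_unique by blast
qed

text \<open>\<open>pixel_along e\<close> is the pixel \<open>p\<^sub>1\<close> whose contour traverses \<open>e\<close> in its given direction,
  \<open>pixel_against e\<close> the pixel \<open>p\<^sub>2\<close> whose contour traverses it in the opposite direction.\<close>

definition pixel_along :: "edge \<Rightarrow> pixel" where
  "pixel_along e = (THE p. e \<in> contour p)"

definition pixel_against :: "edge \<Rightarrow> pixel" where
  "pixel_against e = (THE p. prod.swap e \<in> contour p)"

definition directed_edges :: "nat \<Rightarrow> nat \<Rightarrow> edge set" where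
  "directed_edges Nx Ny =
     (\<Union>p\<in>pixels Nx Ny. contour p) \<union> prod.swap ` (\<Union>p\<in>pixels Nx Ny. contour p)"

text \<open>An edge set lists every mesh edge of the image exactly once, with an arbitrarily chosen
  direction. Edges on the rim of the image are included; their outer neighbour is a cell of
  intensity \<open>0\<close>.\<close>

definition edge_set :: "nat \<Rightarrow> nat \<Rightarrow> edge set \<Rightarrow> bool" where
  "edge_set Nx Ny S \<longleftrightarrow>
     S \<subseteq> directed_edges Nx Ny \<and>
     (\<forall>e\<in>directed_edges Nx Ny. (e \<in> S) \<noteq> (prod.swap e \<in> S))"

definition inner_edge :: "nat \<Rightarrow> nat \<Rightarrow> edge \<Rightarrow> bool" where
  "inner_edge Nx Ny e \<longleftrightarrow> pixel_along e \<in> pixels Nx Ny \<and> pixel_against e \<in> pixels Nx Ny"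

definition rim_pixel :: "nat \<Rightarrow> nat \<Rightarrow> pixel \<Rightarrow> bool" where
  "rim_pixel Nx Ny p \<longleftrightarrow> p \<in> pixels Nx Ny \<and>
     (fst p = 0 \<or> fst p = int Nx - 1 \<or> snd p = 0 \<or> snd p = int Ny - 1)"

definition intensity_jump :: "nat \<Rightarrow> nat \<Rightarrow> (pixel \<Rightarrow> real) \<Rightarrow> edge \<Rightarrow> real" where
  "intensity_jump Nx Ny I e =
     intensity Nx Ny I (pixel_along e) - intensity Nx Ny I (pixel_against e)"


section \<open>Edge contributions\<close>

definition signed_area :: "real \<times> real \<Rightarrow> real \<times> real \<Rightarrow> real" where
  "signed_area A B = (fst A * snd B - snd A * fst B) / 2"

definition orientation_factor :: "real \<times> real \<Rightarrow> real \<times> real \<Rightarrow> real" where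
  "orientation_factor A B = sgn (signed_area A B)"

definition edge_point :: "real \<times> real \<Rightarrow> real \<times> real \<Rightarrow> real \<Rightarrow> real \<times> real" where
  "edge_point A B t =
     (((1 - t) * fst A + (1 + t) * fst B) / 2, ((1 - t) * snd A + (1 + t) * snd B) / 2)"

definition edge_integrand ::
    "real \<Rightarrow> nat \<Rightarrow> int \<Rightarrow> real \<times> real \<Rightarrow> real \<times> real \<Rightarrow> real \<Rightarrow> complex" where
  "edge_integrand C n m A B t =
     of_real C
       * (of_real (zernike_Q n m (polar_radius (edge_point A B t)))
            * exp (- (\<i> * of_int m * of_real (polar_angle (edge_point A B t))))
            / of_real ((polar_radius (edge_point A B t))\<^sup>2))"

definition zernike_A ::
    "nat \<Rightarrow> int \<Rightarrow> real \<times> real \<Rightarrow> real \<times> real \<Rightarrow> real \<Rightarrow> complex" where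
  "zernike_A n m A B = edge_integrand (signed_area A B) n m A B"

text \<open>The same function with the unsigned area \<open>\<bar>C\<bar>\<close> in place of \<open>C\<close>. As
  \<open>orientation_factor A B * signed_area A B = \<bar>signed_area A B\<bar>\<close>, a factor
  \<open>orientation_factor A B\<close> in front of \<open>\<integral> zernike_A\<close> cancels the sign of the area, whereas in
  front of \<open>\<integral> zernike_A_unsigned\<close> it restores it. Both agree if \<open>signed_area A B \<ge> 0\<close>.\<close>

definition zernike_A_unsigned ::
    "nat \<Rightarrow> int \<Rightarrow> real \<times> real \<Rightarrow> real \<times> real \<Rightarrow> real \<Rightarrow> complex" where
  "zernike_A_unsigned n m A B = edge_integrand \<bar>signed_area A B\<bar> n m A B"

definition edge_area :: "real \<times> real \<Rightarrow> real \<Rightarrow> edge \<Rightarrow> real" where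
  "edge_area c h e = signed_area (node_pos c h (fst e)) (node_pos c h (snd e))"

definition edge_moment ::
    "real \<times> real \<Rightarrow> real \<Rightarrow> nat \<Rightarrow> nat \<Rightarrow> (pixel \<Rightarrow> real) \<Rightarrow> nat \<Rightarrow> int \<Rightarrow> edge \<Rightarrow> complex" where
  "edge_moment c h Nx Ny I n m e =
     (let A = node_pos c h (fst e); B = node_pos c h (snd e) in
      of_real (intensity_jump Nx Ny I e) * of_real (orientation_factor A B)
        * integral {-1..1} (zernike_A n m A B))"

definition edge_moment_unsigned ::
    "real \<times> real \<Rightarrow> real \<Rightarrow> nat \<Rightarrow> nat \<Rightarrow> (pixel \<Rightarrow> real) \<Rightarrow> nat \<Rightarrow> int \<Rightarrow> edge \<Rightarrow> complex" where
  "edge_moment_unsigned c h Nx Ny I n m e =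
     (let A = node_pos c h (fst e); B = node_pos c h (snd e) in
      of_real (intensity_jump Nx Ny I e) * of_real (orientation_factor A B)
        * integral {-1..1} (zernike_A_unsigned n m A B))"

end

(* Writing u = x + i y and v = x - i y, both R_n^m(r) e^{-i m theta} and
   G = Q_n^m(r) e^{-i m theta} / r^2 are polynomials in u and v, so the singularity of polar
   coordinates at the origin is only apparent, and Euler's identity for homogeneous polynomials
   gives div (x G, y G) = R_n^m(r) e^{-i m theta}. By Green's theorem the integral over a pixel
   is the flux of (x G, y G) through its four edges. The flux through an edge AB is C times the
   integral of G over [-1, 1] and changes sign with the direction of AB, so in the sum over the
   pixels each edge is counted with the jump of the intensity across it. *)
theory Submission
  imports Defs
begin

section \<open>Green's theorem for rectangles and conjugate monomials\<close>

lemma green_rectangle: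
  fixes P Q P' Q' :: "real \<times> real \<Rightarrow> 'a :: euclidean_space"
  assumes ab: "a \<le> b" and cd: "c \<le> d"
    and P: "\<And>x y. ((\<lambda>x. P (x, y)) has_vector_derivative P' (x, y)) (at x within {a..b})"
    and Q: "\<And>x y. ((\<lambda>y. Q (x, y)) has_vector_derivative Q' (x, y)) (at y within {c..d})"
    and contP: "continuous_on (cbox (a, c) (b, d)) P'"
    and contQ: "continuous_on (cbox (a, c) (b, d)) Q'"
  shows "integral (cbox (a, c) (b, d)) (\<lambda>z. P' z + Q' z) =
    integral {c..d} (\<lambda>y. P (b, y) - P (a, y)) + integral {a..b} (\<lambda>x. Q (x, d) - Q (x, c))"
proof -
  have Px: "integral {a..b} (\<lambda>x. P' (x, y)) = P (b, y) - P (a, y)" for y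
    using fundamental_theorem_of_calculus[OF ab P] by (rule integral_unique)
  have Qy: "integral {c..d} (\<lambda>y. Q' (x, y)) = Q (x, d) - Q (x, c)" for x
    using fundamental_theorem_of_calculus[OF cd Q] by (rule integral_unique)
  have "integral (cbox (a, c) (b, d)) P' =
      integral (cbox a b) (\<lambda>x. integral (cbox c d) (\<lambda>y. P' (x, y)))"
    using contP by (rule integral_prod_continuous)
  \<comment> \<open>Fubini leaves y as the inner variable, but \<open>P'\<close> is an x-derivative,
    so the order is exchanged before the fundamental theorem applies.\<close>
  also have "\<dots> = integral (cbox c d) (\<lambda>y. integral (cbox a b) (\<lambda>x. P' (x, y)))"
    by (rule integral_swap_continuous) (use contP in simp)
  finally have 1: "integral (cbox (a, c) (b, d)) P' = integral {c..d} (\<lambda>y. P (b, y) - P (a, y))"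
    by (simp add: Px)
  have 2: "integral (cbox (a, c) (b, d)) Q' = integral {a..b} (\<lambda>x. Q (x, d) - Q (x, c))"
    using integral_prod_continuous[OF contQ] by (simp add: Qy)
  show ?thesis
    using integral_add[OF integrable_continuous[OF contP] integrable_continuous[OF contQ]]
    by (simp add: 1 2)
qed

text \<open>In the variables u = x + i y and v = x - i y each monomial has a single angular
  frequency, and it is still a polynomial in x and y, hence smooth at the origin.\<close>

definition conj_monomial :: "nat \<Rightarrow> nat \<Rightarrow> real \<times> real \<Rightarrow> complex" where
  "conj_monomial p q z =
     (of_real (fst z) + \<i> * of_real (snd z)) ^ p * (of_real (fst z) - \<i> * of_real (snd z)) ^ q"

lemma continuous_on_conj_monomial [continuous_intros]:
  "continuous_on A f \<Longrightarrow> continuous_on A (\<lambda>x. conj_monomial p q (f x))"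
  unfolding conj_monomial_def by (intro continuous_intros)

text \<open>Writing u = r e^{i theta} and v = r e^{-i theta} collects the powers. The origin needs
  no exception: there u = 0 = r, whatever the angle.\<close>

lemma conj_monomial_polar:
  "conj_monomial p q z = of_real (polar_radius z ^ (p + q)) *
     exp (- (\<i> * of_int (int q - int p) * of_real (polar_angle z)))"
proof -
  define w where "w = Complex (fst z) (snd z)"
  have r: "polar_radius z = cmod w"
    by (simp add: w_def polar_radius_def cmod_def)
  have w: "w = of_real (polar_radius z) * exp (\<i> * of_real (polar_angle z))"
  proof (cases "w = 0")
    case False
    then show ?thesis
      using Arg_eq[of w] by (simp add: r polar_angle_def w_def)
  qed (simp add: r)
  have cnj_w: "cnj w = of_real (polar_radius z) * exp (- (\<i> * of_real (polar_angle z)))"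
    by (subst w) (simp add: exp_cnj)
  have "conj_monomial p q z = w ^ p * cnj w ^ q"
    by (simp add: conj_monomial_def w_def complex_eq_iff Complex_eq)
  also have "\<dots> = of_real (polar_radius z ^ (p + q)) *
      (exp (\<i> * of_real (polar_angle z)) ^ p * exp (- (\<i> * of_real (polar_angle z))) ^ q)"
    unfolding cnj_w by (subst w) (simp add: power_mult_distrib power_add)
  also have "exp (\<i> * of_real (polar_angle z)) ^ p * exp (- (\<i> * of_real (polar_angle z))) ^ q =
      exp (- (\<i> * of_int (int q - int p) * of_real (polar_angle z)))"
    by (simp flip: exp_of_nat_mult exp_add add: algebra_simps)
  finally show ?thesis .
qed

text \<open>Euler's identity \<open>(p + q) g = x \<partial>\<^sub>x g + y \<partial>\<^sub>y g\<close> for the homogeneous polynomial \<open>g\<close>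
  makes \<open>(p + q + 2) g\<close> the divergence of \<open>(x g, y g)\<close>.\<close>

lemma conj_monomial_green:
  fixes p q :: nat and a b c d :: real
  assumes "a \<le> b" "c \<le> d"
  defines "g \<equiv> conj_monomial p q"
  shows "of_nat (p + q + 2) * integral (cbox (a, c) (b, d)) g =
    integral {c..d} (\<lambda>y. of_real b * g (b, y) - of_real a * g (a, y)) +
    integral {a..b} (\<lambda>x. of_real d * g (x, d) - of_real c * g (x, c))"
proof -
  \<comment> \<open>The partial derivatives of \<open>g\<close> by u and v. For p = 0 or q = 0 the
    truncated exponent is harmless, since the factor in front vanishes.\<close>
  define gu where "gu z = of_nat p * conj_monomial (p - 1) q z" for z
  define gv where "gv z = of_nat q * conj_monomial p (q - 1) z" for z
  \<comment> \<open>Product rule for x g and y g, with d/dx = d/du + d/dv and d/dy = i (d/du -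
    d/dv).\<close>
  define P' where "P' z = g z + of_real (fst z) * (gu z + gv z)" for z
  define Q' where "Q' z = g z + of_real (snd z) * (\<i> * (gu z - gv z))" for z
  have P: "((\<lambda>x. of_real (fst (x, y)) * g (x, y)) has_vector_derivative P' (x, y)) (at x within {a..b})"
    for x y
  proof -
    \<comment> \<open>The real coordinate is replaced by a complex variable s, so that ordinary
      complex differentiation applies; the result is then restricted to the real line.\<close>
    have "((\<lambda>s. s * ((s + \<i> * of_real y) ^ p * (s - \<i> * of_real y) ^ q))
        has_field_derivative P' (x, y)) (at (of_real x))"
      unfolding P'_def g_def gu_def gv_def conj_monomial_def
      by (auto intro!: derivative_eq_intros simp: algebra_simps)
    from has_vector_derivative_real_field[OF this] show ?thesis
      by (simp add: g_def conj_monomial_def)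
  qed
  have Q: "((\<lambda>y. of_real (snd (x, y)) * g (x, y)) has_vector_derivative Q' (x, y)) (at y within {c..d})"
    for x y
  proof -
    have "((\<lambda>s. s * ((of_real x + \<i> * s) ^ p * (of_real x - \<i> * s) ^ q))
        has_field_derivative Q' (x, y)) (at (of_real y))"
      unfolding Q'_def g_def gu_def gv_def conj_monomial_def
      by (auto intro!: derivative_eq_intros simp: algebra_simps)
    from has_vector_derivative_real_field[OF this] show ?thesis
      by (simp add: g_def conj_monomial_def)
  qed
  \<comment> \<open>In the variables u and v Euler's identity splits into one relation per
    variable.\<close>
  have "(of_real (fst z) + \<i> * of_real (snd z)) * gu z = of_nat p * g z"
    and "(of_real (fst z) - \<i> * of_real (snd z)) * gv z = of_nat q * g z" for z
    by (cases p; simp add: gu_def g_def conj_monomial_def mult_ac;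
        cases q; simp add: gv_def g_def conj_monomial_def mult_ac)+
  note euler = this
  have "P' z + Q' z = of_nat (p + q + 2) * g z" for z
  proof -
    have "P' z + Q' z = 2 * g z + (of_real (fst z) + \<i> * of_real (snd z)) * gu z
        + (of_real (fst z) - \<i> * of_real (snd z)) * gv z"
      by (simp add: P'_def Q'_def algebra_simps)
    then show ?thesis
      unfolding euler by (simp add: algebra_simps)
  qed
  then have "of_nat (p + q + 2) * integral (cbox (a, c) (b, d)) g =
      integral (cbox (a, c) (b, d)) (\<lambda>z. P' z + Q' z)"
    by simp
  also have "\<dots> = integral {c..d} (\<lambda>y. of_real b * g (b, y) - of_real a * g (a, y)) +
      integral {a..b} (\<lambda>x. of_real d * g (x, d) - of_real c * g (x, c))"
  proof -
    have "continuous_on (cbox (a, c) (b, d)) P'" "continuous_on (cbox (a, c) (b, d)) Q'"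
      unfolding P'_def Q'_def g_def gu_def gv_def by (intro continuous_intros)+
    from green_rectangle[OF assms(1,2) P Q this] show ?thesis by simp
  qed
  finally show ?thesis .
qed

section \<open>Flux through segments and rectangles\<close>

text \<open>The flux of (x g, y g) to the right of the direction of travel, that is, the integral of
  g (x dy - y dx): along \<open>edge_point\<close> the form x dy - y dx is the constant
  \<open>signed_area A B\<close> times dt.\<close>

definition edge_flux :: "(real \<times> real \<Rightarrow> complex) \<Rightarrow> real \<times> real \<Rightarrow> real \<times> real \<Rightarrow> complex" where
  "edge_flux g A B = of_real (signed_area A B) * integral {-1..1} (\<lambda>t. g (edge_point A B t))"

text \<open>Reversal substitutes -t for t, which preserves the integral over the symmetric interval,
  and negates the area.\<close>

lemma edge_flux_swap: "edge_flux g B A = - edge_flux g A B"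
proof -
  have "edge_point B A t = edge_point A B (- t)" for t
    by (simp add: edge_point_def add.commute)
  then have "integral {-1..1} (\<lambda>t. g (edge_point B A t)) = integral {-1..1} (\<lambda>t. g (edge_point A B t))"
    using Henstock_Kurzweil_Integration.integral_reflect_real
      [of 1 "-1" "\<lambda>t. g (edge_point A B t)"] by simp
  moreover have "signed_area B A = - signed_area A B"
    by (simp add: signed_area_def field_simps)
  ultimately show ?thesis
    by (simp add: edge_flux_def)
qed

lemma edge_flux_sum:
  assumes "\<And>k. continuous_on UNIV (g k)"
  shows "edge_flux (\<lambda>z. \<Sum>k\<in>K. f k * g k z) A B = (\<Sum>k\<in>K. f k * edge_flux (g k) A B)"
proof (cases "finite K")
  case True
  have "continuous_on {-1..1} (\<lambda>t. f k * g k (edge_point A B t))" for k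
    unfolding edge_point_def
    by (intro continuous_intros continuous_on_compose2[OF assms]) auto
  then have "integral {-1..1} (\<lambda>t. \<Sum>k\<in>K. f k * g k (edge_point A B t)) =
      (\<Sum>k\<in>K. f k * integral {-1..1} (\<lambda>t. g k (edge_point A B t)))"
    using True by (subst integral_sum) (auto intro: integrable_continuous_interval)
  then show ?thesis
    by (simp add: edge_flux_def sum_distrib_left mult_ac)
qed (simp add: edge_flux_def)

lemma integral_segment_parametrization:
  fixes f :: "real \<Rightarrow> 'a :: euclidean_space"
  assumes "a < b" "continuous_on {a..b} f"
  shows "((b - a) / 2) *\<^sub>R integral {-1..1} (\<lambda>t. f (((1 - t) * a + (1 + t) * b) / 2)) = integral {a..b} f"
proof -
  define h where "h = (b - a) / 2"
  have h: "h > 0" using assms by (simp add: h_def)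
  have "(f has_integral integral {a..b} f) (cbox a b)"
    using assms(2) by (simp add: integrable_integral integrable_continuous_interval)
  \<comment> \<open>Slope half the length and shift to the midpoint: the affine map takes [-1, 1]
    onto [a, b].\<close>
  from has_integral_affinity'[OF this h, of "(a + b) / 2"]
  have "((\<lambda>t. f (h * t + (a + b) / 2)) has_integral (integral {a..b} f /\<^sub>R h))
      (cbox (inverse h * (a - (a + b) / 2)) (inverse h * (b - (a + b) / 2)))"
    unfolding real_scaleR_def DIM_real power_one_right .
  moreover have "inverse h * (a - (a + b) / 2) = -1" "inverse h * (b - (a + b) / 2) = 1"
    using assms by (simp_all add: h_def field_simps)
  moreover have "h * t + (a + b) / 2 = ((1 - t) * a + (1 + t) * b) / 2" for t
    by (simp add: h_def field_simps)
  ultimately have "((\<lambda>t. f (((1 - t) * a + (1 + t) * b) / 2)) has_integral (integral {a..b} f /\<^sub>R h)) {-1..1}"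
    by (simp only: cbox_interval)
  then have "integral {-1..1} (\<lambda>t. f (((1 - t) * a + (1 + t) * b) / 2)) = integral {a..b} f /\<^sub>R h"
    by (rule integral_unique)
  then show ?thesis
    using h unfolding h_def [symmetric] by simp
qed

text \<open>Here dy = 0, so x dy - y dx reduces to - y dx; on a vertical edge it reduces to x
  dy.\<close>

lemma edge_flux_horizontal:
  assumes "a < b" "continuous_on UNIV g"
  shows "edge_flux g (a, y) (b, y) = - (of_real y * integral {a..b} (\<lambda>x. g (x, y)))"
proof -
  have "continuous_on {a..b} (\<lambda>x. g (x, y))"
    by (intro continuous_on_compose2[OF assms(2)] continuous_intros) auto
  note * = integral_segment_parametrization[OF assms(1) this]
  have point: "edge_point (a, y) (b, y) t = (((1 - t) * a + (1 + t) * b) / 2, y)" for t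
    by (simp add: edge_point_def field_simps)
  have area: "signed_area (a, y) (b, y) = - y * ((b - a) / 2)"
    by (simp add: signed_area_def field_simps)
  show ?thesis
    unfolding edge_flux_def area point * [symmetric] scaleR_conv_of_real by simp
qed

lemma edge_flux_vertical:
  assumes "c < d" "continuous_on UNIV g"
  shows "edge_flux g (x, c) (x, d) = of_real x * integral {c..d} (\<lambda>y. g (x, y))"
proof -
  have "continuous_on {c..d} (\<lambda>y. g (x, y))"
    by (intro continuous_on_compose2[OF assms(2)] continuous_intros) auto
  note * = integral_segment_parametrization[OF assms(1) this]
  have point: "edge_point (x, c) (x, d) t = (x, ((1 - t) * c + (1 + t) * d) / 2)" for t
    by (simp add: edge_point_def field_simps)
  have area: "signed_area (x, c) (x, d) = x * ((d - c) / 2)"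
    by (simp add: signed_area_def field_simps)
  show ?thesis
    unfolding edge_flux_def area point * [symmetric] scaleR_conv_of_real by simp
qed

definition rectangle_flux ::
    "(real \<times> real \<Rightarrow> complex) \<Rightarrow> real \<Rightarrow> real \<Rightarrow> real \<Rightarrow> real \<Rightarrow> complex" where
  "rectangle_flux g a b c d =
     edge_flux g (a, c) (b, c) + edge_flux g (b, c) (b, d) +
     edge_flux g (b, d) (a, d) + edge_flux g (a, d) (a, c)"

lemma conj_monomial_rectangle_flux:
  assumes "a < b" "c < d"
  shows "of_nat (p + q + 2) * integral (cbox (a, c) (b, d)) (conj_monomial p q) =
    rectangle_flux (conj_monomial p q) a b c d"
proof -
  define g where "g = conj_monomial p q"
  have cont: "continuous_on UNIV g"
    unfolding g_def by (intro continuous_intros)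
  have int: "(\<lambda>x. w * g (x, y)) integrable_on {a..b}" "(\<lambda>y. w * g (x, y)) integrable_on {c..d}"
    for w x y
    unfolding g_def by (intro integrable_continuous_interval continuous_intros)+
  have "of_nat (p + q + 2) * integral (cbox (a, c) (b, d)) g =
      integral {c..d} (\<lambda>y. of_real b * g (b, y) - of_real a * g (a, y)) +
      integral {a..b} (\<lambda>x. of_real d * g (x, d) - of_real c * g (x, c))"
    unfolding g_def using assms by (intro conj_monomial_green) auto
  \<comment> \<open>The top and left sides run towards decreasing coordinates; they are reversed
    first, because the formulas for axis-parallel edges assume increasing ones.\<close>
  also have "\<dots> = rectangle_flux g a b c d"
    unfolding rectangle_flux_def edge_flux_swap[of g "(b, d)"] edge_flux_swap[of g "(a, d)"]
      edge_flux_horizontal[OF assms(1) cont] edge_flux_vertical[OF assms(2) cont]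
      integral_diff[OF int(1) int(1)] integral_diff[OF int(2) int(2)]
    by simp
  finally show ?thesis by (simp add: g_def)
qed

section \<open>Zernike functions in conjugate monomials\<close>

definition zernike_coeff :: "nat \<Rightarrow> int \<Rightarrow> nat \<Rightarrow> real" where
  "zernike_coeff n m k =
     (let a = nat \<bar>m\<bar> in
        (-1) ^ k * fact (n - k) / (fact k * fact ((n + a) div 2 - k) * fact ((n - a) div 2 - k)))"

text \<open>The exponents solve p + q = n - 2k and q - p = m, which makes this r^{n-2k} e^{-i m
  theta}.\<close>

definition zernike_monomial :: "nat \<Rightarrow> int \<Rightarrow> nat \<Rightarrow> real \<times> real \<Rightarrow> complex" where
  "zernike_monomial n m k =
     conj_monomial (nat ((int (n - 2 * k) - m) div 2)) (nat ((int (n - 2 * k) + m) div 2))"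

text \<open>The polynomial form of G = Q e^{-i m theta} / r^2: integrating s^{n-2k+1} yields the
  denominators, and dividing by r^2 restores the degree n - 2k. It is continuous at the
  origin.\<close>

definition zernike_potential :: "nat \<Rightarrow> int \<Rightarrow> real \<times> real \<Rightarrow> complex" where
  "zernike_potential n m z =
     (\<Sum>k = 0..(n - nat \<bar>m\<bar>) div 2.
        of_real (zernike_coeff n m k / real (n - 2 * k + 2)) * zernike_monomial n m k z)"

definition zernike_kernel :: "nat \<Rightarrow> int \<Rightarrow> real \<times> real \<Rightarrow> complex" where
  "zernike_kernel n m z =
     of_real (zernike_R n m (polar_radius z)) * exp (- (\<i> * of_int m * of_real (polar_angle z)))"

lemma cnj_zernike_V:
  "cnj (zernike_V n m z) = of_real (sqrt ((real n + 1) / pi)) * zernike_kernel n m z"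
  by (simp add: zernike_V_def zernike_kernel_def exp_cnj)

lemma zernike_R_eq:
  "zernike_R n m r = (\<Sum>k = 0..(n - nat \<bar>m\<bar>) div 2. zernike_coeff n m k * r ^ (n - 2 * k))"
  by (simp add: zernike_R_def zernike_coeff_def Let_def)

lemma zernike_Q_eq:
  assumes "0 \<le> r"
  shows "zernike_Q n m r =
    (\<Sum>k = 0..(n - nat \<bar>m\<bar>) div 2. zernike_coeff n m k / real (n - 2 * k + 2) * r ^ (n - 2 * k + 2))"
proof -
  define F where "F r = (\<Sum>k = 0..(n - nat \<bar>m\<bar>) div 2.
    zernike_coeff n m k / real (n - 2 * k + 2) * r ^ (n - 2 * k + 2))" for r :: real
  have "((\<lambda>s. s * zernike_R n m s) has_integral F r - F 0) {0..r}"
  proof (intro fundamental_theorem_of_calculus assms)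
    fix s
    have "((\<lambda>s. zernike_coeff n m k / real (n - 2 * k + 2) * s ^ (n - 2 * k + 2)) has_real_derivative
        s * (zernike_coeff n m k * s ^ (n - 2 * k))) (at s within {0..r})" for k
      by (rule derivative_eq_intros refl)+ (simp add: field_simps)
    then show "(F has_vector_derivative s * zernike_R n m s) (at s within {0..r})"
      unfolding F_def zernike_R_eq sum_distrib_left has_real_derivative_iff_has_vector_derivative[symmetric]
      by (intro DERIV_sum)
  qed
  then show ?thesis
    by (simp add: zernike_Q_def F_def integral_unique)
qed

context
  fixes n :: nat and m :: int
  assumes index: "zernike_index n m"
begin

text \<open>The parity condition makes both halvings exact, and the range of k gives \<bar>m\<bar>
  \<le> n - 2k, so that \<open>nat\<close> truncates nothing.\<close>

lemma zernike_exponents: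
  assumes "k \<le> (n - nat \<bar>m\<bar>) div 2"
  shows "nat ((int (n - 2 * k) - m) div 2) + nat ((int (n - 2 * k) + m) div 2) = n - 2 * k"
    and "int (nat ((int (n - 2 * k) + m) div 2)) - int (nat ((int (n - 2 * k) - m) div 2)) = m"
proof -
  have m: "\<bar>m\<bar> \<le> int n" "even (int n - \<bar>m\<bar>)"
    using index by (auto simp: zernike_index_def)
  then have k: "\<bar>m\<bar> \<le> int n - 2 * int k"
    using assms by linarith
  then have n: "int (n - 2 * k) = int n - 2 * int k"
    by linarith
  have "even (int n - 2 * int k - m)"
    using m(2) by auto
  then obtain u where u: "int n - 2 * int k - m = 2 * u"
    by blast
  then have v: "int n - 2 * int k + m = 2 * (u + m)"
    by simp
  have "0 \<le> u" "0 \<le> u + m"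
    using k u by linarith+
  have eqs: "(int (n - 2 * k) - m) div 2 = u" "(int (n - 2 * k) + m) div 2 = u + m"
    unfolding n u v by simp_all
  show "nat ((int (n - 2 * k) - m) div 2) + nat ((int (n - 2 * k) + m) div 2) = n - 2 * k"
    unfolding eqs using n u \<open>0 \<le> u\<close> \<open>0 \<le> u + m\<close> by linarith
  show "int (nat ((int (n - 2 * k) + m) div 2)) - int (nat ((int (n - 2 * k) - m) div 2)) = m"
    unfolding eqs using \<open>0 \<le> u\<close> \<open>0 \<le> u + m\<close> by simp
qed

lemma zernike_monomial_polar:
  assumes "k \<le> (n - nat \<bar>m\<bar>) div 2"
  shows "zernike_monomial n m k z =
    of_real (polar_radius z ^ (n - 2 * k)) * exp (- (\<i> * of_int m * of_real (polar_angle z)))"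
  unfolding zernike_monomial_def conj_monomial_polar zernike_exponents[OF assms] ..

lemma zernike_kernel_eq:
  "zernike_kernel n m z =
    (\<Sum>k = 0..(n - nat \<bar>m\<bar>) div 2. of_real (zernike_coeff n m k) * zernike_monomial n m k z)"
  unfolding zernike_kernel_def zernike_R_eq of_real_sum sum_distrib_right
  by (intro sum.cong refl) (simp add: zernike_monomial_polar mult_ac)

text \<open>The origin must be excluded: there the quotient is 0 / 0 = 0, whereas for m = 0 the
  potential has the value 1/2 or -1/2.\<close>

lemma zernike_potential_polar:
  assumes "z \<noteq> (0, 0)"
  shows "zernike_potential n m z =
    of_real (zernike_Q n m (polar_radius z)) * exp (- (\<i> * of_int m * of_real (polar_angle z)))
      / of_real ((polar_radius z)\<^sup>2)"
proof -
  have "polar_radius z > 0"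
    using assms by (cases z) (auto simp: polar_radius_def sum_power2_gt_zero_iff)
  then have Q: "zernike_Q n m (polar_radius z) / (polar_radius z)\<^sup>2 =
      (\<Sum>k = 0..(n - nat \<bar>m\<bar>) div 2.
        zernike_coeff n m k / real (n - 2 * k + 2) * polar_radius z ^ (n - 2 * k))"
    by (simp add: zernike_Q_eq sum_divide_distrib power_add power2_eq_square del: of_nat_add)
  have "of_real (zernike_Q n m (polar_radius z)) * exp (- (\<i> * of_int m * of_real (polar_angle z)))
      / of_real ((polar_radius z)\<^sup>2) =
    of_real (zernike_Q n m (polar_radius z) / (polar_radius z)\<^sup>2) *
      exp (- (\<i> * of_int m * of_real (polar_angle z)))"
    by simp
  also have "\<dots> = zernike_potential n m z"
    unfolding Q zernike_potential_def of_real_sum sum_distrib_right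
    by (intro sum.cong refl) (simp add: zernike_monomial_polar mult_ac del: of_nat_add)
  finally show ?thesis ..
qed

lemma continuous_zernike_monomial: "continuous_on A (zernike_monomial n m k)"
  unfolding zernike_monomial_def by (intro continuous_intros)

lemma continuous_zernike_kernel: "continuous_on A (zernike_kernel n m)"
  unfolding zernike_kernel_eq by (intro continuous_intros continuous_zernike_monomial)

text \<open>Term by term, the denominator n - 2k + 2 of the potential cancels the factor p + q + 2
  that Green's theorem gives for a monomial.\<close>

lemma zernike_rectangle:
  assumes "a < b" "c < d"
  shows "integral (cbox (a, c) (b, d)) (zernike_kernel n m) =
    rectangle_flux (zernike_potential n m) a b c d"
proof -
  let ?K = "{0..(n - nat \<bar>m\<bar>) div 2}"
  have "integral (cbox (a, c) (b, d)) (zernike_kernel n m) =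
      (\<Sum>k\<in>?K. of_real (zernike_coeff n m k) * integral (cbox (a, c) (b, d)) (zernike_monomial n m k))"
    unfolding zernike_kernel_eq
    by (subst integral_sum)
       (auto intro!: integrable_continuous continuous_intros continuous_zernike_monomial)
  also have "\<dots> = (\<Sum>k\<in>?K. of_real (zernike_coeff n m k / real (n - 2 * k + 2)) *
      rectangle_flux (zernike_monomial n m k) a b c d)"
  proof (rule sum.cong[OF refl])
    fix k assume "k \<in> ?K"
    then have "rectangle_flux (zernike_monomial n m k) a b c d =
        of_nat (n - 2 * k + 2) * integral (cbox (a, c) (b, d)) (zernike_monomial n m k)"
      unfolding zernike_monomial_def
      by (subst conj_monomial_rectangle_flux[OF assms, symmetric], subst zernike_exponents) auto
    moreover have "complex_of_nat (n - 2 * k + 2) \<noteq> 0"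
      unfolding of_nat_eq_0_iff by simp
    ultimately show "of_real (zernike_coeff n m k) * integral (cbox (a, c) (b, d)) (zernike_monomial n m k)
        = of_real (zernike_coeff n m k / real (n - 2 * k + 2)) * rectangle_flux (zernike_monomial n m k) a b c d"
      by (simp del: of_nat_add)
  qed
  also have "\<dots> = rectangle_flux (zernike_potential n m) a b c d"
    unfolding rectangle_flux_def zernike_potential_def edge_flux_sum[OF continuous_zernike_monomial]
    by (simp only: sum.distrib distrib_left)
  finally show ?thesis .
qed

text \<open>At the origin \<open>zernike_A\<close> has the junk value \<open>0 / 0 = 0\<close>, but an edge through the origin
  has signed area \<open>0\<close>.\<close>

lemma integral_zernike_A:
  "integral {-1..1} (zernike_A n m A B) = edge_flux (zernike_potential n m) A B"
proof -
  have "zernike_A n m A B t = of_real (signed_area A B) * zernike_potential n m (edge_point A B t)" for t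
  proof (cases "edge_point A B t = (0, 0)")
    case True
    then have "(1 - t) * fst A = - ((1 + t) * fst B)" "(1 - t) * snd A = - ((1 + t) * snd B)"
      by (auto simp: edge_point_def)
    \<comment> \<open>With D the determinant of A and B, the relations give (1 - t) D = 0 and (1 +
      t) D = 0, whose sum is 2 D = 0.\<close>
    then have "signed_area A B = 0"
      unfolding signed_area_def by algebra
    then show ?thesis by (simp add: zernike_A_def edge_integrand_def)
  next
    case False
    then show ?thesis
      by (simp add: zernike_A_def edge_integrand_def zernike_potential_polar)
  qed
  then have "zernike_A n m A B = (\<lambda>t. of_real (signed_area A B) * zernike_potential n m (edge_point A B t))"
    by blast
  then show ?thesis
    by (simp add: edge_flux_def)
qed

end

section \<open>Moments as sums over pixels\<close>

lemma zernike_half_open_rectangle: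
  assumes "zernike_index n m" "a < b" "c < d"
  shows "set_integrable lborel ({a..<b} \<times> {c..<d}) (zernike_kernel n m)"
    and "(LINT z:{a..<b} \<times> {c..<d}|lborel. zernike_kernel n m z) =
      rectangle_flux (zernike_potential n m) a b c d"
proof -
  let ?T = "{a..<b} \<times> {c..<d}" and ?C = "cbox (a, c) (b, d)"
  have sub: "box (a, c) (b, d) \<subseteq> ?T" "?T \<subseteq> ?C"
    by (auto simp: cbox_Pair_eq mem_box Basis_prod_def)
  have "set_integrable lborel ?C (zernike_kernel n m)"
    unfolding set_integrable_def
    by (intro borel_integrable_compact compact_cbox continuous_zernike_kernel assms)
  moreover have "?T \<in> sets lborel"
    by (simp flip: borel_prod)
  ultimately show int: "set_integrable lborel ?T (zernike_kernel n m)"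
    using sub(2) by (rule set_integrable_subset)
  \<comment> \<open>Passing from the half-open to the closed rectangle only adds points of the
    frontier; the Lebesgue integral is then identified with the gauge integral used in Green's
    theorem.\<close>
  have "negligible (?C - ?T)"
    using negligible_frontier_interval[of "(a, c)" "(b, d)"] by (rule negligible_subset) (use sub in blast)
  then show "(LINT z:?T|lborel. zernike_kernel n m z) = rectangle_flux (zernike_potential n m) a b c d"
    unfolding set_borel_integral_eq_integral(2)[OF int] zernike_rectangle[OF assms, symmetric]
    by (rule integral_subset_negligible[OF sub(2)])
qed

definition mesh_flux :: "nat \<Rightarrow> int \<Rightarrow> real \<times> real \<Rightarrow> real \<Rightarrow> edge \<Rightarrow> complex" where
  "mesh_flux n m c h e =
     edge_flux (zernike_potential n m) (node_pos c h (fst e)) (node_pos c h (snd e))"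

lemma mesh_flux_swap: "mesh_flux n m c h (prod.swap e) = - mesh_flux n m c h e"
  unfolding mesh_flux_def fst_swap snd_swap by (rule edge_flux_swap)

lemma pixel_integral:
  assumes "zernike_index n m" "0 < h"
  shows "set_integrable lborel (pixel_square c h p) (zernike_kernel n m)"
    and "(LINT z:pixel_square c h p|lborel. zernike_kernel n m z) =
      (\<Sum>e\<in>contour p. mesh_flux n m c h e)"
proof -
  obtain i j where p: "p = (i, j)" by fastforce
  define a b where "a = fst c + of_int i * h" and "b = snd c + of_int j * h"
  have sq: "pixel_square c h p = {a..<a + h} \<times> {b..<b + h}"
    by (simp add: pixel_square_def node_pos_def p a_def b_def)
  have "(\<Sum>e\<in>contour p. mesh_flux n m c h e) =
      rectangle_flux (zernike_potential n m) a (a + h) b (b + h)"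
    by (simp add: contour_def p mesh_flux_def rectangle_flux_def node_pos_def a_def b_def algebra_simps)
  then show "(LINT z:pixel_square c h p|lborel. zernike_kernel n m z) =
      (\<Sum>e\<in>contour p. mesh_flux n m c h e)"
    unfolding sq using zernike_half_open_rectangle(2)[OF assms(1), of a "a + h" b "b + h"] assms(2)
    by simp
  show "set_integrable lborel (pixel_square c h p) (zernike_kernel n m)"
    unfolding sq using assms by (intro zernike_half_open_rectangle) auto
qed

lemma finite_pixels: "finite (pixels Nx Ny)"
  by (simp add: pixels_def)

text \<open>Ensures that restricting the moment to the image domain cuts nothing off any
  pixel.\<close>

lemma pixel_square_subset_image_domain:
  assumes "p \<in> pixels Nx Ny" "0 < h"
  shows "pixel_square c h p \<subseteq> image_domain c h Nx Ny"
proof -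
  obtain i j where p: "p = (i, j)" by fastforce
  have ij: "0 \<le> i" "i + 1 \<le> int Nx" "0 \<le> j" "j + 1 \<le> int Ny"
    using assms by (auto simp: p pixels_def)
  have "0 \<le> real_of_int k * h \<and> real_of_int k * h + h \<le> real N * h" if "0 \<le> k" "k + 1 \<le> int N" for k N
  proof -
    have "real_of_int (k + 1) \<le> real N"
      using that(2) by linarith
    then have "real_of_int (k + 1) * h \<le> real N * h"
      using assms(2) by (intro mult_right_mono) auto
    then show ?thesis using that(1) assms(2) by (simp add: algebra_simps)
  qed
  from this[OF ij(1,2)] this[OF ij(3,4)] show ?thesis
    by (auto simp: pixel_square_def image_domain_def node_pos_def p)
qed

lemma zernike_moment_eq_sum_pixels:
  assumes "zernike_index n m" "0 < h"
  shows "zernike_moment c h Nx Ny I n m = of_real (sqrt ((real n + 1) / pi)) *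
    (\<Sum>p\<in>pixels Nx Ny. of_real (I p) * (\<Sum>e\<in>contour p. mesh_flux n m c h e))"
proof -
  let ?s = "complex_of_real (sqrt ((real n + 1) / pi))"
  let ?F = "\<lambda>p z. indicator (pixel_square c h p) z *\<^sub>R zernike_kernel n m z"
  \<comment> \<open>A pointwise identity, with both sides zero off the domain. It turns the moment
    into a finite sum of pixel integrals without using integrability over the whole domain.\<close>
  have "indicator (image_domain c h Nx Ny) z *\<^sub>R
      (of_real (image_fun c h Nx Ny I z) * cnj (zernike_V n m z)) =
      (\<Sum>p\<in>pixels Nx Ny. (?s * of_real (I p)) * ?F p z)" for z
  proof (cases "z \<in> image_domain c h Nx Ny")
    case True
    then show ?thesis
      by (simp add: image_fun_def cnj_zernike_V sum_distrib_left sum_distrib_right scaleR_conv_of_real mult_ac)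
  next
    case False
    then have "z \<notin> pixel_square c h p" if "p \<in> pixels Nx Ny" for p
      using pixel_square_subset_image_domain[OF that assms(2)] by blast
    then show ?thesis using False by simp
  qed
  then have "zernike_moment c h Nx Ny I n m =
      (LINT z|lborel. (\<Sum>p\<in>pixels Nx Ny. (?s * of_real (I p)) * ?F p z))"
    unfolding zernike_moment_def set_lebesgue_integral_def by simp
  also have "\<dots> = (\<Sum>p\<in>pixels Nx Ny. (?s * of_real (I p)) * (LINT z|lborel. ?F p z))"
    using pixel_integral(1)[OF assms, unfolded set_integrable_def]
    by (simp only: Bochner_Integration.integral_sum Bochner_Integration.integral_mult_right
        integrable_mult_right)
  also have "\<dots> = (\<Sum>p\<in>pixels Nx Ny. (?s * of_real (I p)) * (\<Sum>e\<in>contour p. mesh_flux n m c h e))"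
    unfolding pixel_integral(2)[OF assms, unfolded set_lebesgue_integral_def] ..
  finally show ?thesis
    by (simp add: sum_distrib_left mult.assoc)
qed

section \<open>From pixel contours to mesh edges\<close>

lemma pixel_along_eq: "e \<in> contour p \<Longrightarrow> pixel_along e = p"
  unfolding pixel_along_def by (rule the_equality) (auto intro: contour_unique)

lemma pixel_along_swap: "pixel_along (prod.swap e) = pixel_against e"
  by (simp add: pixel_along_def pixel_against_def)

text \<open>Makes both \<open>THE\<close> descriptions meaningful on every mesh edge, including the
  rim, where \<open>contour_neighbour\<close> supplies a cell outside the image.\<close>

lemma directed_edge_pixels:
  assumes "e \<in> directed_edges Nx Ny"
  shows "e \<in> contour (pixel_along e)" "prod.swap e \<in> contour (pixel_against e)"
    and "pixel_along e \<in> pixels Nx Ny \<or> pixel_against e \<in> pixels Nx Ny"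
proof -
  obtain p where p: "p \<in> pixels Nx Ny" "e \<in> contour p \<or> prod.swap e \<in> contour p"
    using assms by (auto simp: directed_edges_def)
  obtain q1 q2 where q: "e \<in> contour q1" "prod.swap e \<in> contour q2"
    using p(2)
  proof
    assume "e \<in> contour p"
    then show thesis using that contour_neighbour[of e p] by blast
  next
    assume "prod.swap e \<in> contour p"
    then show thesis using that contour_neighbour[of "prod.swap e" p] unfolding swap_swap by blast
  qed
  then have eqs: "pixel_along e = q1" "pixel_against e = q2"
    by (simp_all add: pixel_along_eq flip: pixel_along_swap)
  show "e \<in> contour (pixel_along e)" "prod.swap e \<in> contour (pixel_against e)"
    unfolding eqs by (fact q)+
  show "pixel_along e \<in> pixels Nx Ny \<or> pixel_against e \<in> pixels Nx Ny"
    unfolding eqs using p q contour_unique by blast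
qed

lemma finite_contour: "finite (contour p)"
  by (cases p) (simp add: contour_def)

lemma finite_directed_edges: "finite (directed_edges Nx Ny)"
  by (simp add: directed_edges_def finite_pixels finite_contour)

text \<open>Contours of distinct pixels share no directed edge, so the double sum runs over directed
  edges, each weighted by the intensity of \<open>pixel_along\<close>. Pairing every edge of S with
  its reversal then produces the jump, as L is odd under reversal.\<close>

lemma sum_contours_eq_sum_edges:
  fixes L :: "edge \<Rightarrow> complex"
  assumes S: "edge_set Nx Ny S" and L: "\<And>e. L (prod.swap e) = - L e"
  shows "(\<Sum>p\<in>pixels Nx Ny. of_real (I p) * (\<Sum>e\<in>contour p. L e)) =
    (\<Sum>e\<in>S. of_real (intensity_jump Nx Ny I e) * L e)"
proof -
  let ?D = "directed_edges Nx Ny" and ?U = "\<Union>p\<in>pixels Nx Ny. contour p"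
  let ?J = "\<lambda>e. complex_of_real (intensity Nx Ny I (pixel_along e)) * L e"
  have SD: "S \<subseteq> ?D" and flip: "\<And>e. e \<in> ?D \<Longrightarrow> (e \<in> S) \<noteq> (prod.swap e \<in> S)"
    using S unfolding edge_set_def by blast+
  have disj: "contour p \<inter> contour q = {}" if "p \<noteq> q" for p q
    using that contour_unique by (metis disjoint_iff)
  have "(\<Sum>p\<in>pixels Nx Ny. of_real (I p) * (\<Sum>e\<in>contour p. L e)) =
      (\<Sum>p\<in>pixels Nx Ny. \<Sum>e\<in>contour p. ?J e)"
    unfolding sum_distrib_left by (intro sum.cong refl) (simp add: pixel_along_eq intensity_def)
  also have "\<dots> = (\<Sum>e\<in>?U. ?J e)"
    by (intro sum.UNION_disjoint[symmetric] finite_pixels ballI finite_contour impI disj)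
  \<comment> \<open>The added edges lie on contours of cells outside the image, whose intensity is
    0.\<close>
  also have "\<dots> = (\<Sum>e\<in>?D. ?J e)"
  proof (intro sum.mono_neutral_left finite_directed_edges ballI)
    show "?U \<subseteq> ?D" by (simp add: directed_edges_def)
    fix e assume "e \<in> ?D - ?U"
    then have "pixel_along e \<notin> pixels Nx Ny"
      using directed_edge_pixels(1) by blast
    then show "?J e = 0" by (simp add: intensity_def)
  qed
  also have "?D = S \<union> prod.swap ` S"
  proof -
    have "prod.swap e \<in> ?D" if "e \<in> ?D" for e
      using that by (force simp: directed_edges_def)
    with SD have "prod.swap ` S \<subseteq> ?D" by blast
    moreover have "e \<in> S \<union> prod.swap ` S" if "e \<in> ?D" for e
    proof (cases "e \<in> S")
      case False
      then have "prod.swap e \<in> S" using flip[OF that] by simp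
      then have "prod.swap (prod.swap e) \<in> prod.swap ` S" by (rule imageI)
      then show ?thesis by simp
    qed simp
    ultimately show ?thesis using SD by blast
  qed
  also have "(\<Sum>e\<in>S \<union> prod.swap ` S. ?J e) = (\<Sum>e\<in>S. ?J e) + (\<Sum>e\<in>prod.swap ` S. ?J e)"
  proof (rule sum.union_disjoint)
    show "finite S" "finite (prod.swap ` S)"
      using finite_subset[OF SD finite_directed_edges] by simp_all
    have "prod.swap e \<notin> S" if "e \<in> S" for e
      using SD flip[of e] that by blast
    then show "S \<inter> prod.swap ` S = {}" by auto
  qed
  \<comment> \<open>Reversal turns \<open>pixel_along\<close> into \<open>pixel_against\<close> and
    negates L.\<close>
  also have "(\<Sum>e\<in>prod.swap ` S. ?J e) =
      (\<Sum>e\<in>S. - (of_real (intensity Nx Ny I (pixel_against e)) * L e))"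
    by (subst sum.reindex) (simp_all add: L pixel_along_swap)
  also have "(\<Sum>e\<in>S. ?J e) + \<dots> = (\<Sum>e\<in>S. of_real (intensity_jump Nx Ny I e) * L e)"
    unfolding sum.distrib[symmetric] by (simp add: intensity_jump_def algebra_simps)
  finally show ?thesis .
qed

lemma intensity_jump_rim:
  assumes "e \<in> directed_edges Nx Ny" "\<not> inner_edge Nx Ny e"
    and dark: "\<And>p. rim_pixel Nx Ny p \<Longrightarrow> I p = 0"
  shows "intensity_jump Nx Ny I e = 0"
proof -
  \<comment> \<open>Stated for an arbitrary edge, since either neighbour may be the one inside the
    image; it is applied to e and to its reversal.\<close>
  have rim: "rim_pixel Nx Ny p"
    if "e' \<in> contour p" "prod.swap e' \<in> contour q" "p \<in> pixels Nx Ny" "q \<notin> pixels Nx Ny" for e' p q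
  proof -
    obtain i j where p: "p = (i, j)" by fastforce
    have "q \<in> {(i, j - 1), (i + 1, j), (i, j + 1), (i - 1, j)}"
      using that(1,2) by (cases q) (auto simp: contour_def p)
    then show ?thesis
      using that(3,4) by (auto simp: p rim_pixel_def pixels_def)
  qed
  note e = directed_edge_pixels[OF assms(1)]
  consider "pixel_along e \<in> pixels Nx Ny" "pixel_against e \<notin> pixels Nx Ny"
    | "pixel_along e \<notin> pixels Nx Ny" "pixel_against e \<in> pixels Nx Ny"
    using e(3) assms(2) by (auto simp: inner_edge_def)
  then show ?thesis
  proof cases
    case 1
    with rim[OF e(1,2)] dark show ?thesis by (simp add: intensity_jump_def intensity_def)
  next
    case 2
    with rim[of "prod.swap e"] e(1,2) dark show ?thesis
      by (simp add: intensity_jump_def intensity_def)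
  qed
qed

section \<open>Edge formulas for the moment\<close>

lemma zernike_moment_eq_sum_edges:
  assumes "zernike_index n m" "0 < h" "edge_set Nx Ny S"
  shows "zernike_moment c h Nx Ny I n m = of_real (sqrt ((real n + 1) / pi)) *
    (\<Sum>e\<in>S. of_real (intensity_jump Nx Ny I e) * mesh_flux n m c h e)"
  unfolding zernike_moment_eq_sum_pixels[OF assms(1,2)]
  by (subst sum_contours_eq_sum_edges[OF assms(3)]) (simp_all only: mesh_flux_swap)

text \<open>The flux already carries the sign of the area, so the orientation factor survives as an
  extra sign. It is harmless exactly when the area is positive or the term vanishes anyway.\<close>

lemma edge_moment_eq:
  assumes "zernike_index n m"
  shows "edge_moment c h Nx Ny I n m e =
    of_real (intensity_jump Nx Ny I e) * of_real (sgn (edge_area c h e)) * mesh_flux n m c h e"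
  by (simp add: edge_moment_def Let_def integral_zernike_A[OF assms] mesh_flux_def
      orientation_factor_def edge_area_def)

lemma mesh_flux_collinear: "edge_area c h e = 0 \<Longrightarrow> mesh_flux n m c h e = 0"
  by (simp add: mesh_flux_def edge_flux_def edge_area_def)

text \<open>Replacing C by \<bar>C\<bar> = sgn(C) C contributes a second sign; the two cancel unless
  the area is 0, and then the flux is 0 as well.\<close>

lemma edge_moment_unsigned_eq:
  assumes "zernike_index n m"
  shows "edge_moment_unsigned c h Nx Ny I n m e =
    of_real (intensity_jump Nx Ny I e) * mesh_flux n m c h e"
proof -
  let ?A = "node_pos c h (fst e)" and ?B = "node_pos c h (snd e)"
  have "zernike_A_unsigned n m ?A ?B = (\<lambda>t. of_real (sgn (edge_area c h e)) * zernike_A n m ?A ?B t)"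
    by (rule ext) (simp add: zernike_A_unsigned_def zernike_A_def edge_integrand_def edge_area_def abs_sgn)
  then have "integral {-1..1} (zernike_A_unsigned n m ?A ?B) =
      of_real (sgn (edge_area c h e)) * mesh_flux n m c h e"
    by (simp add: mesh_flux_def flip: integral_zernike_A[OF assms])
  then show ?thesis
    by (cases "edge_area c h e" "0 :: real" rule: linorder_cases)
       (simp_all add: mesh_flux_collinear edge_moment_unsigned_def Let_def orientation_factor_def flip: edge_area_def)
qed

text \<open>For n = m = 0 the potential is the constant 1/2 and [-1, 1] has length 2. This provides
  an index with nonzero flux for every edge not collinear with the origin.\<close>

lemma mesh_flux_0_0: "mesh_flux 0 0 c h e = of_real (edge_area c h e)"
  by (simp add: mesh_flux_def edge_flux_def edge_area_def zernike_potential_def zernike_coeff_def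
      zernike_monomial_def conj_monomial_def scaleR_conv_of_real)

theorem mainTheorem4:
  fixes c :: "real \<times> real" and h :: real and Nx Ny :: nat
    and I :: "pixel \<Rightarrow> real" and S :: "edge set"
    and n :: nat and m :: int
  assumes "0 < Nx" and "0 < Ny" and "0 < h"
    and "image_domain c h Nx Ny \<subseteq> cball 0 1"
    and "edge_set Nx Ny S"
    and "zernike_index n m"
  shows
    \<comment> \<open>edges directed such that the signed areas are nonnegative\<close>
    "((\<forall>e\<in>S. 0 \<le> edge_area c h e) \<longrightarrow>
       zernike_moment c h Nx Ny I n m =
         of_real (sqrt ((real n + 1) / pi)) * (\<Sum>e\<in>S. edge_moment c h Nx Ny I n m e))
    \<comment> \<open>edges directed arbitrarily\<close>
   \<and> zernike_moment c h Nx Ny I n m =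
         of_real (sqrt ((real n + 1) / pi)) * (\<Sum>e\<in>S. edge_moment_unsigned c h Nx Ny I n m e)
    \<comment> \<open>only inner edges are needed if the image is dark along its rim\<close>
   \<and> ((\<forall>p. rim_pixel Nx Ny p \<longrightarrow> I p = 0) \<longrightarrow>
       zernike_moment c h Nx Ny I n m =
         of_real (sqrt ((real n + 1) / pi)) *
           (\<Sum>e\<in>{e\<in>S. inner_edge Nx Ny e}. edge_moment_unsigned c h Nx Ny I n m e))
    \<comment> \<open>edges between pixels of identical intensity vanish from the summation\<close>
   \<and> zernike_moment c h Nx Ny I n m =
         of_real (sqrt ((real n + 1) / pi)) *
           (\<Sum>e\<in>{e\<in>S. intensity Nx Ny I (pixel_along e) \<noteq> intensity Nx Ny I (pixel_against e)}.
              edge_moment_unsigned c h Nx Ny I n m e)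
   \<and> (\<forall>e\<in>S. intensity Nx Ny I (pixel_along e) = intensity Nx Ny I (pixel_against e) \<longrightarrow>
        intensity_jump Nx Ny I e = 0 \<and>
        edge_moment c h Nx Ny I n m e = 0 \<and> edge_moment_unsigned c h Nx Ny I n m e = 0)
    \<comment> \<open>an edge whose line integral does not vanish contributes iff its neighbours differ;
        an edge not collinear with the origin has a nonvanishing line integral for some index\<close>
   \<and> (\<forall>e\<in>S. integral {-1..1} (zernike_A n m (node_pos c h (fst e)) (node_pos c h (snd e))) \<noteq> 0 \<longrightarrow>
        (edge_moment c h Nx Ny I n m e \<noteq> 0 \<longleftrightarrow>
         intensity Nx Ny I (pixel_along e) \<noteq> intensity Nx Ny I (pixel_against e)))
   \<and> (\<forall>e\<in>S. edge_area c h e \<noteq> 0 \<longrightarrow>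
        ((\<exists>n' m'. zernike_index n' m' \<and> edge_moment c h Nx Ny I n' m' e \<noteq> 0) \<longleftrightarrow>
         intensity Nx Ny I (pixel_along e) \<noteq> intensity Nx Ny I (pixel_against e)))"
proof -
  let ?Z = "zernike_moment c h Nx Ny I n m" and ?s = "complex_of_real (sqrt ((real n + 1) / pi))"
  let ?M = "edge_moment c h Nx Ny I n m" and ?U = "edge_moment_unsigned c h Nx Ny I n m"
  let ?differ = "\<lambda>e. intensity Nx Ny I (pixel_along e) \<noteq> intensity Nx Ny I (pixel_against e)"
  note U = edge_moment_unsigned_eq[OF assms(6)] and M = edge_moment_eq
  have jump: "intensity_jump Nx Ny I e \<noteq> 0 \<longleftrightarrow> ?differ e" for e
    by (simp add: intensity_jump_def)
  have S: "S \<subseteq> directed_edges Nx Ny"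
    using assms(5) unfolding edge_set_def by blast
  then have fin: "finite S"
    using finite_directed_edges by (rule finite_subset)
  have Z: "?Z = ?s * (\<Sum>e\<in>S. ?U e)"
    unfolding U using assms by (intro zernike_moment_eq_sum_edges)
  \<comment> \<open>One reduction serves both restricted sums, over inner edges and over edges with
    differing neighbours: dropped terms have jump 0.\<close>
  have restrict: "?Z = ?s * (\<Sum>e\<in>{e\<in>S. P e}. ?U e)"
    if "\<And>e. e \<in> S \<Longrightarrow> \<not> P e \<Longrightarrow> intensity_jump Nx Ny I e = 0" for P
  proof -
    have "(\<Sum>e\<in>S. ?U e) = (\<Sum>e\<in>{e\<in>S. P e}. ?U e)"
      using fin that by (intro sum.mono_neutral_right) (auto simp: U)
    then show ?thesis unfolding Z by simp
  qed
  have "?Z = ?s * (\<Sum>e\<in>S. ?M e)" if "\<forall>e\<in>S. 0 \<le> edge_area c h e"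
  proof -
    have "?M e = ?U e" if "0 \<le> edge_area c h e" for e
      using that by (cases "edge_area c h e = 0")
        (simp_all add: M[OF assms(6)] U mesh_flux_collinear)
    with that show ?thesis unfolding Z by simp
  qed
  moreover have "?Z = ?s * (\<Sum>e\<in>{e\<in>S. inner_edge Nx Ny e}. ?U e)"
    if "\<forall>p. rim_pixel Nx Ny p \<longrightarrow> I p = 0"
    using that S by (intro restrict intensity_jump_rim) auto
  moreover have "?Z = ?s * (\<Sum>e\<in>{e\<in>S. ?differ e}. ?U e)"
    using jump by (intro restrict) blast
  moreover have "intensity_jump Nx Ny I e = 0 \<and> ?M e = 0 \<and> ?U e = 0" if "\<not> ?differ e" for e
    using that jump[of e] by (simp add: M[OF assms(6)] U)
  moreover have "?M e \<noteq> 0 \<longleftrightarrow> ?differ e"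
    if "integral {-1..1} (zernike_A n m (node_pos c h (fst e)) (node_pos c h (snd e))) \<noteq> 0" for e
  proof -
    have "mesh_flux n m c h e \<noteq> 0"
      using that by (simp add: mesh_flux_def integral_zernike_A[OF assms(6)])
    \<comment> \<open>A nonzero flux forces a nonzero area, so the orientation factor cannot cancel
      the term.\<close>
    moreover from this have "edge_area c h e \<noteq> 0"
      using mesh_flux_collinear by blast
    ultimately show ?thesis
      using jump[of e] by (simp add: M[OF assms(6)] sgn_zero_iff)
  qed
  moreover have "(\<exists>n' m'. zernike_index n' m' \<and> edge_moment c h Nx Ny I n' m' e \<noteq> 0) \<longleftrightarrow> ?differ e"
    if "edge_area c h e \<noteq> 0" for e
  proof
    assume "\<exists>n' m'. zernike_index n' m' \<and> edge_moment c h Nx Ny I n' m' e \<noteq> 0"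
    then show "?differ e"
      using jump[of e] by (auto simp: M)
  next
    assume "?differ e"
    moreover have "zernike_index 0 0"
      by (simp add: zernike_index_def)
    ultimately have "zernike_index 0 0 \<and> edge_moment c h Nx Ny I 0 0 e \<noteq> 0"
      using jump[of e] that by (simp add: M mesh_flux_0_0 sgn_zero_iff)
    then show "\<exists>n' m'. zernike_index n' m' \<and> edge_moment c h Nx Ny I n' m' e \<noteq> 0"
      by blast
  qed
  ultimately show ?thesis
    using Z by blast
qed

end
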